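(* Suppose single-shot SBFT is run with a synchronizer satisfying the specification (P1)-(P5) given in the context for a view $\mathcal V$ and $d=2\delta$. Assume all processes are correct and let $v\ge\mathcal V$ be a view such that $F(v)>5\delta$. Then all processes decide at $v$ by time $E_{\rm last}(v)+3\delta$.
   Context: Model. There are $n=3f+1$ processes $\mathcal P=\{p_1,\dots,p_n\}$, at most $f$ of which are faulty (Byzantine, behaving arbitrarily); the others are correct. A quorum is a set of $2f+1$ processes. Processes communicate over authenticated point-to-point links. Partial synchrony: there are a time $\mathsf{GST}$ and a bound $\delta$, both unknown to the protocol, such that after $\mathsf{GST}$ messages between correct processes are delayed by at most $\delta$; before $\mathsf{GST}$ messages may be arbitrarily delayed or lost (self-addressed messages are never lost). Local clocks may drift unboundedly before $\mathsf{GST}$ and do not drift from real time after it. Local processing takes zero time. $\langle m\rangle_i$ denotes $m$ signed by $p_i$; signatures are unforgeable and $\mathsf{hash}$ is collision-resistant (both idealized as perfect). Each correct process has a proposal $\mathtt{myval}()$ satisfying a given predicate $\mathsf{valid}$. Synchronizer. Views are $1,2,\dots$; $0$ denotes an invalid view. A synchronizer issues notifications $\mathtt{new\_view}(v)$ at each correct process, which then enters $v$ and stays in it until it enters another view. Each correct process eventually calls the synchronizer's function $\mathtt{start}()$. The timeout function $F:\{0,1,2,\dots\}\to\mathsf{Time}$ is monotone, $F(0)=0$, and for every $\theta$ there is $v$ with $F(v')>\theta$ for all $v'\ge v$. $E_i(v)$ is the time when correct $p_i$ enters $v$; $E_{\rm first}(v)$, $E_{\rm last}(v)$ are the earliest and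 latest times when some correct process enters $v$. Specification, for a view $\mathcal V$: (P1) if $v<v'$ and $E_i(v),E_i(v')$ are defined then $E_i(v)<E_i(v')$; (P2) $E_{\rm first}(\mathcal V)\ge\mathsf{GST}$; (P3) every correct process enters every $v\ge\mathcal V$; (P4) $E_{\rm last}(v)\le E_{\rm first}(v)+d$ for all $v\ge\mathcal V$; (P5) $E_{\rm first}(v+1)\ge E_{\rm first}(v)+F(v)$ for all $v\ge\mathcal V$. Single-shot (all-to-all) SBFT (code of $p_i$), with fast-path timeout function $F_f$. $\mathsf{leader}(v)=p_{((v-1)\bmod n)+1}$. Variables $\mathsf{curr\_view},\mathsf{locked\_view},\mathsf{pre\_view}$ are initially $0$; $\mathsf{curr\_val},\mathsf{prepared\_val},\mathsf{cert},\mathsf{voted}$ are initially $\bot$; $\mathsf{timer\_fast\_path}$ is a timer. A handler runs when its trigger and precondition hold; messages for views higher than the current one are buffered (for each type and sender, only the one with the highest view is kept). "All" includes the sender. 1. Upon $\mathtt{new\_view}(v)$: $\mathsf{curr\_view}:=v$; $\mathsf{voted}:=$ false; send $\langle\mathtt{NEWLEADER}(v,\mathsf{locked\_view},\mathsf{prepared\_val},\mathsf{cert},\mathsf{pre\_view},\mathsf{curr\_val})\rangle_i$ to $\mathsf{leader}(v)$. 2. (Once per view.) When messages $M=\{\langle\mathtt{NEWLEADER}(v,view_j,val_j,cert_j,pre_j,cur_j)\rangle_j\mid p_j\in Q\}$ are received for a quorum $Q$, with $\mathsf{curr\_view}=v$, $p_i=\mathsf{leader}(v)$ and ValidNewLeader$(m)$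 for all $m\in M$: compute $(x_{\rm slow},v_{\rm slow},x_{\rm fast},v_{\rm fast})$ by the Selection rule below; if $v_{\rm slow}\ge v_{\rm fast}$ and $v_{\rm slow}>0$, send $\langle\mathtt{PROPOSE}(v,x_{\rm slow},M)\rangle_i$ to all; else if $v_{\rm fast}>v_{\rm slow}$, send $\langle\mathtt{PROPOSE}(v,x_{\rm fast},M)\rangle_i$ to all; else send $\langle\mathtt{PROPOSE}(v,\mathtt{myval}(),M)\rangle_i$ to all. 3. When $m=\langle\mathtt{PROPOSE}(v,x,\_)\rangle_j$ is received, with $\mathsf{curr\_view}=v$, $\mathsf{voted}=$ false, SafeProposal$(m)$: $\mathsf{curr\_val}:=x$; $\mathsf{pre\_view}:=v$; $\mathsf{voted}:=$ true; stop $\mathsf{timer\_fast\_path}$ and start it with duration $F_f(v)$; send $\langle\mathtt{PREPARED}(v,\mathsf{hash}(x))\rangle_i$ to all. 4. (Fast path.) When $\{\langle\mathtt{PREPARED}(v,h)\rangle_j\mid p_j\in\mathcal P\}$ (from all processes) is received, with $\mathsf{curr\_view}=v$, $\mathsf{voted}=$ true, $\mathsf{hash}(\mathsf{curr\_val})=h$: decide $\mathsf{curr\_val}$. 5. When $\mathsf{timer\_fast\_path}$ has expired and $C=\{\langle\mathtt{PREPARED}(v,h)\rangle_j\mid p_j\in Q\}$ has been received for at least a quorum $Q$, with $\mathsf{curr\_view}=v$, $\mathsf{voted}=$ true, $\mathsf{hash}(\mathsf{curr\_val})=h$: $\mathsf{prepared\_val}:=\mathsf{curr\_val}$; $\mathsf{locked\_view}:=v$;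 $\mathsf{cert}:=C$; send $\langle\mathtt{COMMITTED}(v,h)\rangle_i$ to all. 6. When $\{\langle\mathtt{COMMITTED}(v,h)\rangle_j\mid p_j\in Q\}$ is received for a quorum $Q$, with $\mathsf{curr\_view}=\mathsf{locked\_view}=v$, $\mathsf{hash}(\mathsf{curr\_val})=h$: decide $\mathsf{curr\_val}$. Selection rule. $(x_{\rm slow},v_{\rm slow})=(val_j,view_j)$ for some $j$ with $view_j=\max\{view_k\mid p_k\in Q\}$ if this maximum is nonzero, else $(\bot,0)$. Let $D$ be the set of pairs $(x,u)$ for which there is $P\subseteq Q$ with $|P|=f+1$, $cur_j=x$ for all $p_j\in P$, and $u=\min\{pre_j\mid p_j\in P\}$. Let $u^*=\max\{u\mid(\_,u)\in D\}$; if there is exactly one $x$ with $(x,u^* )\in D$, then $(x_{\rm fast},v_{\rm fast})=(x,u^* )$; otherwise (including $D=\emptyset$) $(x_{\rm fast},v_{\rm fast})=(\bot,0)$. View-1 optimization: in view $1$ the leader proposes $\mathtt{myval}()$ immediately on entering, without waiting for $\mathtt{NEWLEADER}$ messages (which need not be sent to it), and SafeProposal for view $1$ only requires that the sender is $\mathsf{leader}(1)$ and the value is valid. Predicates: prepared$(C,v,h)$ iff $C=\{\langle\mathtt{PREPARED}(v,h)\rangle_j\mid p_j\in Q\}$ for some quorum $Q$ (a certificate with more than $2f+1$ messages is also accepted). ValidNewLeader$(\langle\mathtt{NEWLEADER}(v',v,x,C,v_0,x_0)\rangle_{\_})$ iff $v\le v_0<v'$ and ($v\ne0$ implies prepared$(C,v,\mathsf{hash}(x))$).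 SafeProposal$(\langle\mathtt{PROPOSE}(v,x,M)\rangle_i)$ iff $p_i=\mathsf{leader}(v)$, $\mathsf{valid}(x)$, $M$ is a set of $\mathtt{NEWLEADER}$ messages for view $v$ signed by the members of some quorum $Q$, all satisfying ValidNewLeader, and for $v_{\rm slow},v_{\rm fast},x_{\rm slow},x_{\rm fast}$ computed from $M$ by the Selection rule: ($v_{\rm slow}\ge v_{\rm fast}$ and $v_{\rm slow}>0$ imply $x=x_{\rm slow}$) and ($v_{\rm slow}<v_{\rm fast}$ implies $x=x_{\rm fast}$). *)

theory Defs
  imports Complex_Main
begin

type_synonym proc = nat
type_synonym view = nat
type_synonym time = real

text \<open>
  A signed message is represented by a constructor whose proc argument is the signer.
  The undefined value is \<^term>\<open>None\<close>, both for proposals and for certificates. PREPARED and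
  NEWLEADER messages have types of their own because they are embedded into other messages.
\<close>

datatype 'h prepared_msg = Prepared (psigner: proc) (pview: view) (phash: 'h)

type_synonym 'h certificate = "'h prepared_msg set"

datatype ('v, 'h) newleader_msg =
  Newleader (nsigner: proc) (nview: view) (nlocked: view) (nval: "'v option")
    (ncert: "'h certificate option") (npre: view) (ncur: "'v option")

datatype ('v, 'h) msg =
    NEWLEADER "('v, 'h) newleader_msg"
  | PROPOSE proc view "'v option" "('v, 'h) newleader_msg set"
  | PREPARED "'h prepared_msg"
  | COMMITTED proc view 'h

primrec signer :: "('v, 'h) msg \<Rightarrow> proc" where
  "signer (NEWLEADER m) = nsigner m"
| "signer (PROPOSE j v x M) = j"
| "signer (PREPARED m) = psigner m"
| "signer (COMMITTED j v h) = j"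

primrec view_of :: "('v, 'h) msg \<Rightarrow> view" where
  "view_of (NEWLEADER m) = nview m"
| "view_of (PROPOSE j v x M) = v"
| "view_of (PREPARED m) = pview m"
| "view_of (COMMITTED j v h) = v"

fun same_type :: "('v, 'h) msg \<Rightarrow> ('v, 'h) msg \<Rightarrow> bool" where
  "same_type (NEWLEADER _) (NEWLEADER _) = True"
| "same_type (PROPOSE _ _ _ _) (PROPOSE _ _ _ _) = True"
| "same_type (PREPARED _) (PREPARED _) = True"
| "same_type (COMMITTED _ _ _) (COMMITTED _ _ _) = True"
| "same_type _ _ = False"

definition newleader_parts :: "('v, 'h) newleader_msg \<Rightarrow> ('v, 'h) msg set" where
  "newleader_parts m = insert (NEWLEADER m)
     (case ncert m of None \<Rightarrow> {} | Some C \<Rightarrow> PREPARED ` C)"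

primrec signed_parts :: "('v, 'h) msg \<Rightarrow> ('v, 'h) msg set" where
  "signed_parts (NEWLEADER m) = newleader_parts m"
| "signed_parts (PROPOSE j v x M) = insert (PROPOSE j v x M) (\<Union>m\<in>M. newleader_parts m)"
| "signed_parts (PREPARED m) = {PREPARED m}"
| "signed_parts (COMMITTED j v h) = {COMMITTED j v h}"

text \<open>
  The selection rule takes the locked value of \<^emph>\<open>some\<close> message with the maximal locked view. The
  field pick resolves this choice; it may differ between processes and is only required to return
  a message with the maximal locked view (see the locale sbft_execution below).
\<close>

record ('v, 'h) sbft_params =
  max_faulty :: nat
  hash :: "'v option \<Rightarrow> 'h"
  valid :: "'v \<Rightarrow> bool"
  myval :: "proc \<Rightarrow> 'v"
  fast_timeout :: "view \<Rightarrow> time"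
  pick :: "proc \<Rightarrow> ('v, 'h) newleader_msg set \<Rightarrow> ('v, 'h) newleader_msg"

definition procs :: "('v, 'h) sbft_params \<Rightarrow> proc set" where
  "procs P = {1..3 * max_faulty P + 1}"

definition quorum :: "('v, 'h) sbft_params \<Rightarrow> proc set \<Rightarrow> bool" where
  "quorum P Q \<longleftrightarrow> Q \<subseteq> procs P \<and> card Q = 2 * max_faulty P + 1"

definition leader :: "('v, 'h) sbft_params \<Rightarrow> view \<Rightarrow> proc" where
  "leader P v = (v - 1) mod (3 * max_faulty P + 1) + 1"

definition prepared :: "('v, 'h) sbft_params \<Rightarrow> 'h certificate \<Rightarrow> view \<Rightarrow> 'h \<Rightarrow> bool" where
  "prepared P C v h \<longleftrightarrow>
     (\<exists>Q \<subseteq> procs P. card Q \<ge> 2 * max_faulty P + 1 \<and> C = (\<lambda>j. Prepared j v h) ` Q)"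

definition valid_newleader :: "('v, 'h) sbft_params \<Rightarrow> ('v, 'h) newleader_msg \<Rightarrow> bool" where
  "valid_newleader P m \<longleftrightarrow>
     nlocked m \<le> npre m \<and> npre m < nview m \<and>
     (nlocked m \<noteq> 0 \<longrightarrow> (\<exists>C. ncert m = Some C \<and> prepared P C (nlocked m) (hash P (nval m))))"

definition newleader_quorum ::
    "('v, 'h) sbft_params \<Rightarrow> view \<Rightarrow> ('v, 'h) newleader_msg set \<Rightarrow> bool" where
  "newleader_quorum P v M \<longleftrightarrow>
     (\<exists>Q. quorum P Q \<and> bij_betw nsigner M Q) \<and>
     (\<forall>m\<in>M. nview m = v \<and> valid_newleader P m)"

definition select_slow ::
    "('v, 'h) sbft_params \<Rightarrow> proc \<Rightarrow> ('v, 'h) newleader_msg set \<Rightarrow> 'v option \<times> view" where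
  "select_slow P p M =
     (if Max (nlocked ` M) \<noteq> 0 then (nval (pick P p M), nlocked (pick P p M)) else (None, 0))"

text \<open>Below, N stands for the messages of the f + 1 processes agreeing on a value.\<close>

definition fast_candidates ::
    "('v, 'h) sbft_params \<Rightarrow> ('v, 'h) newleader_msg set \<Rightarrow> ('v option \<times> view) set" where
  "fast_candidates P M =
     {(x, u). \<exists>N \<subseteq> M. card N = max_faulty P + 1 \<and> (\<forall>m\<in>N. ncur m = x) \<and> u = Min (npre ` N)}"

definition select_fast ::
    "('v, 'h) sbft_params \<Rightarrow> ('v, 'h) newleader_msg set \<Rightarrow> 'v option \<times> view" where
  "select_fast P M =
     (let D = fast_candidates P M; u = Max (snd ` D)
      in if \<exists>!x. (x, u) \<in> D then (THE x. (x, u) \<in> D, u) else (None, 0))"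

definition proposal ::
    "('v, 'h) sbft_params \<Rightarrow> proc \<Rightarrow> ('v, 'h) newleader_msg set \<Rightarrow> 'v option" where
  "proposal P p M =
     (let (x_slow, v_slow) = select_slow P p M; (x_fast, v_fast) = select_fast P M
      in if v_slow \<ge> v_fast \<and> v_slow > 0 then x_slow
         else if v_fast > v_slow then x_fast
         else Some (myval P p))"

text \<open>
  safe_proposal P p j v x M is process p's evaluation of SafeProposal on a PROPOSE message
  signed by j. In view 1 leaders propose without NEWLEADER messages, so M is not inspected.
\<close>

definition safe_proposal ::
    "('v, 'h) sbft_params \<Rightarrow> proc \<Rightarrow> proc \<Rightarrow> view \<Rightarrow> 'v option \<Rightarrow> ('v, 'h) newleader_msg set \<Rightarrow> bool"
where
  "safe_proposal P p j v x M \<longleftrightarrow>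
     j = leader P v \<and> (\<exists>y. x = Some y \<and> valid P y) \<and>
     (v \<noteq> 1 \<longrightarrow>
       newleader_quorum P v M \<and>
       (let (x_slow, v_slow) = select_slow P p M; (x_fast, v_fast) = select_fast P M
        in (v_slow \<ge> v_fast \<and> v_slow > 0 \<longrightarrow> x = x_slow) \<and>
           (v_slow < v_fast \<longrightarrow> x = x_fast)))"

datatype handler = Leading | Voting | Fast_Deciding | Locking | Slow_Deciding

text \<open>
  The timer holds the local clock value at which it expires. The field handled is bookkeeping:
  the handlers that the process has already run in its current view.
\<close>

record ('v, 'h) pstate =
  curr_view :: view
  locked_view :: view
  pre_view :: view
  curr_val :: "'v option"
  prepared_val :: "'v option"
  cert :: "'h certificate option"
  voted :: "bool option"
  timer_fast_path :: "time option"
  inbox :: "('v, 'h) msg set"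
  handled :: "handler set"

definition init_state :: "('v, 'h) pstate" where
  "init_state = \<lparr>curr_view = 0, locked_view = 0, pre_view = 0, curr_val = None,
     prepared_val = None, cert = None, voted = None, timer_fast_path = None,
     inbox = {}, handled = {}\<rparr>"

text \<open>
  Buffering: among the messages of one type and signer for views higher than the current one,
  only one with the highest view is kept (the earliest received one if there are several).
\<close>

definition buffered_like :: "('v, 'h) pstate \<Rightarrow> ('v, 'h) msg \<Rightarrow> ('v, 'h) msg set" where
  "buffered_like s m =
     {m' \<in> inbox s. same_type m m' \<and> signer m' = signer m \<and> curr_view s < view_of m'}"

definition store :: "('v, 'h) msg \<Rightarrow> ('v, 'h) pstate \<Rightarrow> ('v, 'h) msg set" where
  "store m s =
     (if view_of m \<le> curr_view s then insert m (inbox s)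
      else if \<exists>m' \<in> buffered_like s m. view_of m \<le> view_of m' then inbox s
      else insert m (inbox s - buffered_like s m))"

datatype ('v, 'h) event =
    Idle
  | Start
  | New_View view
  | Receive "('v, 'h) msg"
  | Lead "('v, 'h) newleader_msg set"
  | Vote proc "'v option" "('v, 'h) newleader_msg set"
  | Fast_Decide 'v
  | Lock "'h certificate"
  | Slow_Decide 'v

fun handler_of :: "('v, 'h) event \<Rightarrow> handler option" where
  "handler_of (Lead M) = Some Leading"
| "handler_of (Vote j x M) = Some Voting"
| "handler_of (Fast_Decide x) = Some Fast_Deciding"
| "handler_of (Lock C) = Some Locking"
| "handler_of (Slow_Decide x) = Some Slow_Deciding"
| "handler_of _ = None"

text \<open>
  enabled P p c s e: in local state s and at local clock value c, process p can perform e.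
  Events that do not correspond to message or timer handlers are controlled by the environment
  and restricted in the locales below.
\<close>

primrec enabled ::
    "('v, 'h) sbft_params \<Rightarrow> proc \<Rightarrow> time \<Rightarrow> ('v, 'h) pstate \<Rightarrow> ('v, 'h) event \<Rightarrow> bool"
where
  "enabled P p c s Idle \<longleftrightarrow> True"
| "enabled P p c s Start \<longleftrightarrow> True"
| "enabled P p c s (New_View v) \<longleftrightarrow> True"
| "enabled P p c s (Receive m) \<longleftrightarrow> True"
| "enabled P p c s (Lead M) \<longleftrightarrow>
     Leading \<notin> handled s \<and> curr_view s \<noteq> 1 \<and> p = leader P (curr_view s) \<and>
     NEWLEADER ` M \<subseteq> inbox s \<and> newleader_quorum P (curr_view s) M"
| "enabled P p c s (Vote j x M) \<longleftrightarrow>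
     PROPOSE j (curr_view s) x M \<in> inbox s \<and> voted s = Some False \<and>
     safe_proposal P p j (curr_view s) x M"
| "enabled P p c s (Fast_Decide x) \<longleftrightarrow>
     curr_val s = Some x \<and> voted s = Some True \<and>
     (\<forall>j \<in> procs P. PREPARED (Prepared j (curr_view s) (hash P (curr_val s))) \<in> inbox s)"
| "enabled P p c s (Lock C) \<longleftrightarrow>
     (\<exists>e. timer_fast_path s = Some e \<and> e \<le> c) \<and> voted s = Some True \<and>
     PREPARED ` C \<subseteq> inbox s \<and> prepared P C (curr_view s) (hash P (curr_val s))"
| "enabled P p c s (Slow_Decide x) \<longleftrightarrow>
     curr_val s = Some x \<and> curr_view s = locked_view s \<and>
     (\<exists>Q. quorum P Q \<and>
       (\<forall>j \<in> Q. COMMITTED j (curr_view s) (hash P (curr_val s)) \<in> inbox s))"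

primrec effect ::
    "('v, 'h) sbft_params \<Rightarrow> time \<Rightarrow> ('v, 'h) event \<Rightarrow> ('v, 'h) pstate \<Rightarrow> ('v, 'h) pstate"
where
  "effect P c Idle s = s"
| "effect P c Start s = s"
| "effect P c (New_View v) s = s\<lparr>curr_view := v, voted := Some False, handled := {}\<rparr>"
| "effect P c (Receive m) s = s\<lparr>inbox := store m s\<rparr>"
| "effect P c (Lead M) s = s\<lparr>handled := insert Leading (handled s)\<rparr>"
| "effect P c (Vote j x M) s =
     s\<lparr>curr_val := x, pre_view := curr_view s, voted := Some True,
       timer_fast_path := Some (c + fast_timeout P (curr_view s)),
       handled := insert Voting (handled s)\<rparr>"
| "effect P c (Fast_Decide x) s = s\<lparr>handled := insert Fast_Deciding (handled s)\<rparr>"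
| "effect P c (Lock C) s =
     s\<lparr>prepared_val := curr_val s, locked_view := curr_view s, cert := Some C,
       handled := insert Locking (handled s)\<rparr>"
| "effect P c (Slow_Decide x) s = s\<lparr>handled := insert Slow_Deciding (handled s)\<rparr>"

text \<open>
  The messages, paired with their destinations, that p sends when performing an event in state s.
  On entering view 1, the leader proposes right away and no NEWLEADER messages are sent.
\<close>

primrec sends ::
    "('v, 'h) sbft_params \<Rightarrow> proc \<Rightarrow> ('v, 'h) pstate \<Rightarrow> ('v, 'h) event \<Rightarrow> (proc \<times> ('v, 'h) msg) set"
where
  "sends P p s Idle = {}"
| "sends P p s Start = {}"
| "sends P p s (New_View v) =
     (if v = 1
      then if p = leader P 1 then procs P \<times> {PROPOSE p 1 (Some (myval P p)) {}} else {}
      else {(leader P v, NEWLEADER (Newleader p v (locked_view s) (prepared_val s) (cert s)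
                                     (pre_view s) (curr_val s)))})"
| "sends P p s (Receive m) = {}"
| "sends P p s (Lead M) = procs P \<times> {PROPOSE p (curr_view s) (proposal P p M) M}"
| "sends P p s (Vote j x M) = procs P \<times> {PREPARED (Prepared p (curr_view s) (hash P x))}"
| "sends P p s (Fast_Decide x) = {}"
| "sends P p s (Lock C) = procs P \<times> {COMMITTED p (curr_view s) (hash P (curr_val s))}"
| "sends P p s (Slow_Decide x) = {}"

text \<open>
  A handler that is enabled and has not yet run in the current view. Only Leading is restricted
  to a single run per view by its precondition; the others may run again, but are not obliged to.
\<close>

definition pending :: "('v, 'h) sbft_params \<Rightarrow> proc \<Rightarrow> time \<Rightarrow> ('v, 'h) pstate \<Rightarrow> bool" where
  "pending P p c s \<longleftrightarrow>
     (\<exists>e h. handler_of e = Some h \<and> h \<notin> handled s \<and> enabled P p c s e)"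

text \<open>
  The k-th step of a run is event ev k, performed by process who k at real time tm k, and leads
  from the global state st k to st (Suc k). Only steps of correct processes are recorded; the
  faulty ones show up through the messages that correct processes receive from them.
\<close>

record ('v, 'h) run =
  who :: "nat \<Rightarrow> proc"
  ev :: "nat \<Rightarrow> ('v, 'h) event"
  tm :: "nat \<Rightarrow> time"
  st :: "nat \<Rightarrow> proc \<Rightarrow> ('v, 'h) pstate"

definition correct :: "('v, 'h) sbft_params \<Rightarrow> proc set \<Rightarrow> proc set" where
  "correct P faulty = procs P - faulty"

definition sent_at ::
    "('v, 'h) sbft_params \<Rightarrow> ('v, 'h) run \<Rightarrow> nat \<Rightarrow> proc \<Rightarrow> proc \<Rightarrow> ('v, 'h) msg \<Rightarrow> bool"
where
  "sent_at P R k q p m \<longleftrightarrow> who R k = q \<and> (p, m) \<in> sends P q (st R k q) (ev R k)"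

definition received_at :: "('v, 'h) run \<Rightarrow> nat \<Rightarrow> proc \<Rightarrow> ('v, 'h) msg \<Rightarrow> bool" where
  "received_at R k p m \<longleftrightarrow> who R k = p \<and> ev R k = Receive m"

definition decides_at :: "('v, 'h) run \<Rightarrow> proc \<Rightarrow> view \<Rightarrow> 'v \<Rightarrow> time \<Rightarrow> bool" where
  "decides_at R p v x t \<longleftrightarrow>
     (\<exists>k. who R k = p \<and> (ev R k = Fast_Decide x \<or> ev R k = Slow_Decide x) \<and>
          curr_view (st R k p) = v \<and> tm R k = t)"

text \<open>
  clk p maps real time to the local clock of p. It may behave arbitrarily before GST, except for
  running backwards; right-continuity makes sure that there is a first moment at which a timer
  has expired.

  Received messages come over an authenticated link from their signer (assumption authenticated),
  and signatures of correct processes inside messages are unforgeable (assumption unforgeable).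

  The assumption urgent expresses that local processing takes zero time: time cannot pass while a
  correct process has a pending handler.
\<close>

locale sbft_execution =
  fixes P :: "('v, 'h) sbft_params"
    and faulty :: "proc set"
    and GST \<delta> :: time
    and clk :: "proc \<Rightarrow> time \<Rightarrow> time"
    and R :: "('v, 'h) run"
  assumes faulty: "faulty \<subseteq> procs P" "card faulty \<le> max_faulty P"
    and collision_resistant: "inj (hash P)"
    and valid_myval: "p \<in> correct P faulty \<Longrightarrow> valid P (myval P p)"
    and pick: "\<lbrakk>finite M; M \<noteq> {}\<rbrakk> \<Longrightarrow>
                 pick P p M \<in> M \<and> nlocked (pick P p M) = Max (nlocked ` M)"
    and delta_nonneg: "\<delta> \<ge> 0"
    and clk_mono: "p \<in> correct P faulty \<Longrightarrow> mono (clk p)"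
    and clk_right_cont: "p \<in> correct P faulty \<Longrightarrow> continuous (at_right t) (clk p)"
    and clk_no_drift: "\<lbrakk>p \<in> correct P faulty; t \<ge> GST\<rbrakk> \<Longrightarrow> clk p t - clk p GST = t - GST"
    and initial: "st R 0 p = init_state"
    and step: "who R k \<in> correct P faulty \<and>
               enabled P (who R k) (clk (who R k) (tm R k)) (st R k (who R k)) (ev R k) \<and>
               st R (Suc k) = (st R k)(who R k :=
                 effect P (clk (who R k) (tm R k)) (ev R k) (st R k (who R k)))"
    and tm_mono: "mono (tm R)"
    and tm_unbounded: "\<exists>k. T < tm R k"
    and urgent: "\<lbrakk>p \<in> correct P faulty; tm R k \<le> t; t < tm R (Suc k)\<rbrakk> \<Longrightarrow>
                 \<not> pending P p (clk p t) (st R (Suc k) p)"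
    and started: "p \<in> correct P faulty \<Longrightarrow> \<exists>k. who R k = p \<and> ev R k = Start"
    and authenticated: "received_at R k p m \<Longrightarrow>
                 signer m \<in> procs P \<and>
                 (signer m \<in> correct P faulty \<longrightarrow> (\<exists>k' < k. sent_at P R k' (signer m) p m))"
    and unforgeable: "\<lbrakk>received_at R k p m; m' \<in> signed_parts m; signer m' \<in> correct P faulty\<rbrakk> \<Longrightarrow>
                 \<exists>k' < k. \<exists>q. sent_at P R k' (signer m') q m'"
    and timely: "\<lbrakk>sent_at P R k q p m; q \<in> correct P faulty; p \<in> correct P faulty; tm R k \<ge> GST\<rbrakk> \<Longrightarrow>
                 \<exists>k' > k. received_at R k' p m \<and> tm R k' \<le> tm R k + \<delta>"
    and self_reliable: "\<lbrakk>sent_at P R k p p m; p \<in> correct P faulty\<rbrakk> \<Longrightarrow>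
                 \<exists>k' > k. received_at R k' p m"

definition enters :: "('v, 'h) run \<Rightarrow> proc \<Rightarrow> view \<Rightarrow> time \<Rightarrow> bool" where
  "enters R p v t \<longleftrightarrow> (\<exists>k. who R k = p \<and> ev R k = New_View v \<and> tm R k = t)"

text \<open>E_first and E_last are meaningful only if some process in C enters v.\<close>

definition E_first :: "('v, 'h) run \<Rightarrow> proc set \<Rightarrow> view \<Rightarrow> time" where
  "E_first R C v = Min {t. \<exists>p\<in>C. enters R p v t}"

definition E_last :: "('v, 'h) run \<Rightarrow> proc set \<Rightarrow> view \<Rightarrow> time" where
  "E_last R C v = Max {t. \<exists>p\<in>C. enters R p v t}"

definition timeout_function :: "(view \<Rightarrow> time) \<Rightarrow> bool" where
  "timeout_function F \<longleftrightarrow> mono F \<and> F 0 = 0 \<and> (\<forall>\<theta>. \<exists>v. \<forall>v' \<ge> v. F v' > \<theta>)"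

text \<open>
  The assumption once says that the time at which a process enters a given view is uniquely
  determined whenever it is defined.
\<close>

locale synchronizer =
  fixes R :: "('v, 'h) run"
    and C :: "proc set"
    and GST :: time
    and F :: "view \<Rightarrow> time"
    and V :: view
    and d :: time
  assumes timeout: "timeout_function F"
    and V_pos: "V \<ge> 1"
    and views: "ev R k = New_View v \<Longrightarrow> v \<ge> 1"
    and once: "\<lbrakk>who R k \<in> C; who R k' = who R k; ev R k = New_View v; ev R k' = New_View v\<rbrakk> \<Longrightarrow> k = k'"
    and P1: "\<lbrakk>p \<in> C; v < v'; enters R p v t; enters R p v' t'\<rbrakk> \<Longrightarrow> t < t'"
    and P2: "E_first R C V \<ge> GST"
    and P3: "\<lbrakk>p \<in> C; v \<ge> V\<rbrakk> \<Longrightarrow> \<exists>t. enters R p v t"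
    and P4: "v \<ge> V \<Longrightarrow> E_last R C v \<le> E_first R C v + d"
    and P5: "v \<ge> V \<Longrightarrow> E_first R C (v + 1) \<ge> E_first R C v + F v"

end

theory Submission
  imports Defs
begin

text \<open>
  Only the fast path is needed. Since F v exceeds 5\<delta> and entries to v are at most 2\<delta> apart, no
  process leaves v before E_last v + 3\<delta>. The leader holds a quorum of NEWLEADER messages by
  E_last v + \<delta>; its proposal, on receipt by E_last v + 2\<delta>, passes everyone's SafeProposal check,
  and the resulting 3f + 1 matching PREPARED messages are received by E_last v + 3\<delta>. The check
  does not depend on which message with the maximal locked view a process picks: two certificates
  for the same view share a signer, and a correct process prepares only one value per view.

  That a handler has run by time T is shown by looking at the state after the last step with time
  at most T: time then advances past T, so by urgency no handler is pending at T.
\<close>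

section \<open>Processes, quorums and the selection rule\<close>

lemma leader_in_procs: "leader P v \<in> procs P"
proof -
  have "(v - 1) mod (3 * max_faulty P + 1) < 3 * max_faulty P + 1"
    by (rule mod_less_divisor) simp
  then show ?thesis unfolding leader_def procs_def by simp
qed

lemma quorum_exists: "\<exists>Q. quorum P Q"
  unfolding quorum_def procs_def
  by (rule exI[of _ "{1..2 * max_faulty P + 1}"]) auto

lemma finite_procs: "finite (procs P)"
  by (simp add: procs_def)

lemma large_sets_intersect:
  assumes "Q \<subseteq> procs P" "Q' \<subseteq> procs P"
    and "card Q \<ge> 2 * max_faulty P + 1" "card Q' \<ge> 2 * max_faulty P + 1"
  shows "Q \<inter> Q' \<noteq> {}"
proof
  assume "Q \<inter> Q' = {}"
  moreover have "finite Q" "finite Q'"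
    using assms finite_procs finite_subset by blast+
  ultimately have "card Q + card Q' = card (Q \<union> Q')" by (simp add: card_Un_disjoint)
  also have "\<dots> \<le> card (procs P)" using assms by (intro card_mono finite_procs) auto
  finally show False using assms by (simp add: procs_def)
qed

lemma newleader_quorum_finite:
  assumes "newleader_quorum P v M"
  shows "finite M" "M \<noteq> {}"
proof -
  obtain Q where Q: "quorum P Q" "bij_betw nsigner M Q"
    using assms by (auto simp: newleader_quorum_def)
  then have "card M \<noteq> 0"
    using bij_betw_same_card[OF Q(2)] by (simp add: quorum_def)
  then show "finite M" "M \<noteq> {}" by (auto intro: card_ge_0_finite)
qed

text \<open>The fallback of the rule carries view 0, so a nonzero view stems from the branch with a
  unique value.\<close>

lemma select_fast_candidate:
  assumes "select_fast P M = (x, u)" "u \<noteq> 0"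
  shows "(x, u) \<in> fast_candidates P M"
proof -
  let ?D = "fast_candidates P M"
  let ?u = "Max (snd ` ?D)"
  have ex: "\<exists>!y. (y, ?u) \<in> ?D"
    using assms by (auto simp: select_fast_def Let_def split: if_splits)
  then have "select_fast P M = (THE y. (y, ?u) \<in> ?D, ?u)"
    by (simp add: select_fast_def Let_def)
  with assms have "x = (THE y. (y, ?u) \<in> ?D)" "u = ?u" by auto
  with theI'[OF ex] show ?thesis by simp
qed

section \<open>Local states along a run without faulty processes\<close>

locale correct_run =
  sbft_execution P faulty GST \<delta> clk R + synchronizer R "correct P faulty" GST F V d
  for P :: "('v, 'h) sbft_params"
    and faulty GST \<delta> clk
    and R :: "('v, 'h) run"
    and F V d +
  assumes all_correct: "correct P faulty = procs P"
begin

lemma who_in_procs: "who R k \<in> procs P"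
  using step all_correct by blast

lemma st_Suc:
  "st R (Suc k) p =
    (if who R k = p then effect P (clk p (tm R k)) (ev R k) (st R k p) else st R k p)"
  using step[of k] by auto

lemma enabled_step:
  "who R k = p \<Longrightarrow> enabled P p (clk p (tm R k)) (st R k p) (ev R k)"
  using step[of k] by auto

lemma curr_view_entered:
  "curr_view (st R k p) \<noteq> 0 \<Longrightarrow>
    \<exists>k'<k. who R k' = p \<and> ev R k' = New_View (curr_view (st R k p))"
proof (induction k)
  case 0
  then show ?case by (simp add: initial init_state_def)
next
  case (Suc k)
  show ?case
  proof (cases "\<exists>w. who R k = p \<and> ev R k = New_View w")
    case True
    then show ?thesis by (auto simp: st_Suc)
  next
    case False
    then have "curr_view (st R (Suc k) p) = curr_view (st R k p)"
      by (cases "ev R k") (auto simp: st_Suc)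
    with Suc show ?thesis by (metis less_Suc_eq)
  qed
qed

text \<open>Were the process already in a view u with w <= u, it would have entered u at an earlier
  step: u = w contradicts \<open>once\<close>, and w < u contradicts \<open>P1\<close>, which orders
  the two entry times the other way round.\<close>

lemma new_view_increases:
  assumes "who R k = p" "ev R k = New_View w"
  shows "curr_view (st R k p) < w"
proof (rule ccontr)
  let ?u = "curr_view (st R k p)"
  assume "\<not> ?thesis"
  moreover have "w \<ge> 1" using views assms by blast
  ultimately have "w \<le> ?u" "?u \<noteq> 0" by auto
  obtain k' where k': "k' < k" "who R k' = p" "ev R k' = New_View ?u"
    using curr_view_entered[OF \<open>?u \<noteq> 0\<close>] by blast
  have p: "p \<in> correct P faulty" using assms who_in_procs all_correct by blast
  have "?u \<noteq> w" using once[of k k' w] k' assms p by auto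
  with \<open>w \<le> ?u\<close> have "w < ?u" by simp
  then have "tm R k < tm R k'"
    using P1[OF p, of w ?u "tm R k" "tm R k'"] k' assms unfolding enters_def by blast
  moreover have "tm R k' \<le> tm R k" using tm_mono k'(1) by (simp add: monoD)
  ultimately show False by simp
qed

lemma curr_view_mono:
  assumes "a \<le> b"
  shows "curr_view (st R a p) \<le> curr_view (st R b p)"
  using assms
proof (induction b rule: dec_induct)
  case (step n)
  have "curr_view (st R n p) \<le> curr_view (st R (Suc n) p)"
    using new_view_increases[of n p] by (cases "ev R n") (auto simp: st_Suc less_imp_le)
  with step show ?case by simp
qed simp

text \<open>Views never decrease, so equal views at both ends exclude any \<open>New_View\<close> in
  between, and no other event clears \<open>handled\<close> or resets \<open>voted\<close>.\<close>

lemma view_state_persists: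
  assumes "a \<le> b" "curr_view (st R a p) = curr_view (st R b p)"
  shows "handled (st R a p) \<subseteq> handled (st R b p)"
    and "voted (st R a p) = Some True \<Longrightarrow> voted (st R b p) = Some True"
proof -
  have "handled (st R a p) \<subseteq> handled (st R b p) \<and>
    (voted (st R a p) = Some True \<longrightarrow> voted (st R b p) = Some True)"
    using assms
  proof (induction b rule: dec_induct)
    case (step n)
    have "curr_view (st R a p) \<le> curr_view (st R n p)"
      "curr_view (st R n p) \<le> curr_view (st R (Suc n) p)"
      using step(1) by (simp_all add: curr_view_mono)
    with step.prems have eq: "curr_view (st R a p) = curr_view (st R n p)"
      "curr_view (st R n p) = curr_view (st R (Suc n) p)" by auto
    have "ev R n \<noteq> New_View w" if "who R n = p" for w
    proof
      assume w: "ev R n = New_View w"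
      with that have "curr_view (st R (Suc n) p) = w" by (simp add: st_Suc)
      with new_view_increases[OF that w] eq(2) show False by simp
    qed
    then have "handled (st R n p) \<subseteq> handled (st R (Suc n) p)"
      "voted (st R n p) = Some True \<Longrightarrow> voted (st R (Suc n) p) = Some True"
      by (cases "ev R n"; auto simp: st_Suc)+
    with step.IH[OF eq(1)] show ?case by blast
  qed simp
  then show "handled (st R a p) \<subseteq> handled (st R b p)"
    and "voted (st R a p) = Some True \<Longrightarrow> voted (st R b p) = Some True" by auto
qed

lemma handled_event:
  "h \<in> handled (st R k p) \<Longrightarrow>
    \<exists>k'<k. who R k' = p \<and> handler_of (ev R k') = Some h \<and>
      curr_view (st R k' p) = curr_view (st R k p)"
proof (induction k)
  case 0
  then show ?case by (simp add: initial init_state_def)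
next
  case (Suc k)
  show ?case
  proof (cases "who R k = p \<and> handler_of (ev R k) = Some h")
    case True
    then have "curr_view (st R (Suc k) p) = curr_view (st R k p)"
      by (cases "ev R k") (auto simp: st_Suc)
    with True show ?thesis by (intro exI[of _ k]) auto
  next
    case False
    with Suc.prems have "h \<in> handled (st R k p)"
      "curr_view (st R (Suc k) p) = curr_view (st R k p)"
      by (cases "ev R k"; auto simp: st_Suc split: if_splits)+
    with Suc.IH show ?thesis by (metis less_Suc_eq)
  qed
qed

text \<open>The witness is the latest \<open>Vote\<close>: no event after it has changed
  \<open>curr_val\<close>, and an entry to a new view would have reset \<open>voted\<close>.\<close>

lemma voted_event:
  "voted (st R k p) = Some True \<Longrightarrow>
    \<exists>k'<k. \<exists>j M. who R k' = p \<and> ev R k' = Vote j (curr_val (st R k p)) M \<and>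
      curr_view (st R k' p) = curr_view (st R k p)"
proof (induction k)
  case 0
  then show ?case by (simp add: initial init_state_def)
next
  case (Suc k)
  show ?case
  proof (cases "\<exists>j x M. who R k = p \<and> ev R k = Vote j x M")
    case True
    then show ?thesis by (intro exI[of _ k]) (auto simp: st_Suc)
  next
    case False
    with Suc.prems have "voted (st R k p) = Some True"
      "curr_view (st R (Suc k) p) = curr_view (st R k p)"
      "curr_val (st R (Suc k) p) = curr_val (st R k p)"
      by (cases "ev R k"; auto simp: st_Suc split: if_splits)+
    with Suc.IH show ?thesis by (metis less_Suc_eq)
  qed
qed

lemma voted_not_None: "curr_view (st R k p) \<noteq> 0 \<Longrightarrow> voted (st R k p) \<noteq> None"
proof (induction k)
  case 0
  then show ?case by (simp add: initial init_state_def)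
next
  case (Suc k)
  then show ?case by (cases "ev R k") (auto simp: st_Suc split: if_splits)
qed

text \<open>An invariant strong enough to make every NEWLEADER message of a correct process pass
  \<open>valid_newleader\<close> and carry valid values. The clause for \<open>voted\<close> keeps
  it inductive at \<open>Lock\<close>, which copies \<open>curr_view\<close> and
  \<open>curr_val\<close> into the locked fields.\<close>

definition well_formed :: "('v, 'h) pstate \<Rightarrow> bool" where
  "well_formed s \<longleftrightarrow>
     locked_view s \<le> pre_view s \<and> pre_view s \<le> curr_view s \<and>
     (voted s = Some True \<longrightarrow> pre_view s = curr_view s \<and> (\<exists>y. curr_val s = Some y \<and> valid P y)) \<and>
     (pre_view s \<noteq> 0 \<longrightarrow> (\<exists>y. curr_val s = Some y \<and> valid P y)) \<and>
     (locked_view s \<noteq> 0 \<longrightarrow>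
       (\<exists>C. cert s = Some C \<and> prepared P C (locked_view s) (hash P (prepared_val s))) \<and>
       (\<exists>y. prepared_val s = Some y \<and> valid P y))"

lemma well_formed_st: "well_formed (st R k p)"
proof (induction k)
  case 0
  then show ?case by (simp add: initial init_state_def well_formed_def)
next
  case (Suc k)
  show ?case
  proof (cases "who R k = p")
    case False
    with Suc show ?thesis by (simp add: st_Suc)
  next
    case True
    note en = enabled_step[OF True]
    show ?thesis
      using Suc en True new_view_increases[OF True]
      by (cases "ev R k") (auto simp: st_Suc well_formed_def safe_proposal_def)
  qed
qed

section \<open>Origin and uniqueness of messages\<close>

lemma sent_from_view:
  assumes "sent_at P R k q p m"
  shows "who R k = q" "signer m = q"
    and "view_of m \<noteq> 0 \<Longrightarrow> \<exists>k'\<le>k. who R k' = q \<and> ev R k' = New_View (view_of m)"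
proof -
  show who: "who R k = q" and "signer m = q"
    using assms by (cases "ev R k"; auto simp: sent_at_def split: if_splits)+
  assume "view_of m \<noteq> 0"
  moreover have "view_of m = curr_view (st R k q) \<or> ev R k = New_View (view_of m)"
    using assms by (cases "ev R k") (auto simp: sent_at_def split: if_splits)
  ultimately show "\<exists>k'\<le>k. who R k' = q \<and> ev R k' = New_View (view_of m)"
    using curr_view_entered[of k q] who by (metis le_refl less_imp_le)
qed

lemma inbox_received: "m \<in> inbox (st R k p) \<Longrightarrow> \<exists>k'<k. received_at R k' p m"
proof (induction k)
  case 0
  then show ?case by (simp add: initial init_state_def)
next
  case (Suc k)
  show ?case
  proof (cases "received_at R k p m")
    case True
    then show ?thesis by blast
  next
    case False
    with Suc.prems have "m \<in> inbox (st R k p)"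
      by (cases "ev R k") (auto simp: st_Suc received_at_def store_def split: if_splits)
    with Suc.IH show ?thesis by (metis less_Suc_eq)
  qed
qed

lemma received_sent: "received_at R k p m \<Longrightarrow> \<exists>k'<k. sent_at P R k' (signer m) p m"
  using authenticated all_correct by blast

lemma inbox_sent: "m \<in> inbox (st R k p) \<Longrightarrow> \<exists>k'<k. sent_at P R k' (signer m) p m"
  using inbox_received received_sent by (meson less_trans)

text \<open>The first run puts \<open>Leading\<close> into \<open>handled\<close>, where it stays
  while the view lasts and blocks the guard of \<open>Lead\<close>; \<open>vote_once\<close> works
  likewise through \<open>voted\<close>.\<close>

lemma lead_once:
  assumes "who R a = q" "who R b = q" "ev R a = Lead M" "ev R b = Lead M'"
    and "curr_view (st R a q) = curr_view (st R b q)"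
  shows "a = b"
proof -
  have False if "i < j" "who R i = q" "who R j = q" "ev R i = Lead N" "ev R j = Lead N'"
    "curr_view (st R i q) = curr_view (st R j q)" for i j N N'
  proof -
    have "Leading \<in> handled (st R (Suc i) q)"
      "curr_view (st R (Suc i) q) = curr_view (st R j q)" using that by (simp_all add: st_Suc)
    then have "Leading \<in> handled (st R j q)"
      using view_state_persists(1)[of "Suc i" j q] that(1) by auto
    then show False using enabled_step[OF that(3)] that(5) by simp
  qed
  note no = this
  show ?thesis
  proof (cases a b rule: linorder_cases)
    case less
    show ?thesis using no[OF less assms] by simp
  next
    case greater
    show ?thesis using no[OF greater assms(2,1,4,3) assms(5)[symmetric]] by simp
  qed
qed

lemma vote_once:
  assumes "who R a = q" "who R b = q" "ev R a = Vote j x M" "ev R b = Vote j' x' M'"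
    and "curr_view (st R a q) = curr_view (st R b q)"
  shows "a = b"
proof -
  have False if "i < j" "who R i = q" "who R j = q" "ev R i = Vote l x N" "ev R j = Vote l' x' N'"
    "curr_view (st R i q) = curr_view (st R j q)" for i j l l' x x' N N'
  proof -
    have "voted (st R (Suc i) q) = Some True"
      "curr_view (st R (Suc i) q) = curr_view (st R j q)" using that by (simp_all add: st_Suc)
    then have "voted (st R j q) = Some True"
      using view_state_persists(2)[of "Suc i" j q] that(1) by auto
    then show False using enabled_step[OF that(3)] that(5) by simp
  qed
  note no = this
  show ?thesis
  proof (cases a b rule: linorder_cases)
    case less
    show ?thesis using no[OF less assms] by simp
  next
    case greater
    show ?thesis using no[OF greater assms(2,1,4,3) assms(5)[symmetric]] by simp
  qed
qed

lemma prepared_unique: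
  assumes "sent_at P R a q p (PREPARED (Prepared j w h))"
    and "sent_at P R b q p' (PREPARED (Prepared j' w h'))"
  shows "h = h'"
proof -
  have vote: "\<exists>l x M. ev R k = Vote l x M \<and> who R k = q \<and> curr_view (st R k q) = w \<and> h = hash P x"
    if "sent_at P R k q p (PREPARED (Prepared j w h))" for k p j h
    using that by (cases "ev R k") (auto simp: sent_at_def split: if_splits)
  obtain l x M where a: "ev R a = Vote l x M" "who R a = q" "curr_view (st R a q) = w" "h = hash P x"
    using vote[OF assms(1)] by blast
  obtain l' x' M' where b: "ev R b = Vote l' x' M'" "who R b = q" "curr_view (st R b q) = w"
    "h' = hash P x'" using vote[OF assms(2)] by blast
  have "a = b" using vote_once[of a q b l x M l' x' M'] a b by simp
  with a b show ?thesis by simp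
qed

text \<open>View 1 is separate because its leader proposes on entry; the guard of
  \<open>Lead\<close> excludes that view, so the two sources never overlap.\<close>

lemma propose_cases:
  assumes "sent_at P R k q p (PROPOSE j w x M)"
  shows "q = j" "who R k = j" "j = leader P w"
    and "w = 1 \<and> ev R k = New_View 1 \<and> x = Some (myval P j) \<and> M = {} \<or>
      w \<noteq> 1 \<and> ev R k = Lead M \<and> curr_view (st R k j) = w \<and> x = proposal P j M \<and>
      newleader_quorum P w M \<and> NEWLEADER ` M \<subseteq> inbox (st R k j)"
  using assms enabled_step[of k q]
  by (cases "ev R k"; auto simp: sent_at_def split: if_splits)+

text \<open>Both senders are \<open>leader P w\<close>. In view 1 the proposal is a fixed value of
  that process, and in other views \<open>lead_once\<close> applies.\<close>

lemma propose_unique: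
  assumes "sent_at P R a q p (PROPOSE j w x M)" "sent_at P R b q' p' (PROPOSE j' w x' M')"
  shows "x = x'" "M = M'"
proof -
  note c = propose_cases[OF assms(1)] and c' = propose_cases[OF assms(2)]
  have "x = x' \<and> M = M'"
  proof (cases "w = 1")
    case True
    with c c' show ?thesis by auto
  next
    case False
    with c c' have "a = b" using lead_once[of a j b M M'] by auto
    with False c c' show ?thesis by auto
  qed
  then show "x = x'" "M = M'" by auto
qed

text \<open>A NEWLEADER message is fixed by the single entry to its view, a PROPOSE message by the
  leader, and a PREPARED message by the single vote. This makes buffering harmless: a kept message
  of the same type, signer and view is the same message.\<close>

lemma message_unique:
  assumes "sent_at P R a q p m" "sent_at P R b q p' m'" "same_type m m'" "view_of m = view_of m'"
    and "\<And>j w h. m \<noteq> COMMITTED j w h"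
  shows "m = m'"
proof (cases m)
  case (NEWLEADER n)
  then obtain n' where n': "m' = NEWLEADER n'" using assms(3) by (cases m') auto
  have E: "who R k = q \<and> ev R k = New_View (nview n) \<and> n = Newleader q (nview n)
      (locked_view (st R k q)) (prepared_val (st R k q)) (cert (st R k q))
      (pre_view (st R k q)) (curr_val (st R k q))" if "sent_at P R k q p (NEWLEADER n)" for k n p
    using that by (cases "ev R k") (auto simp: sent_at_def split: if_splits)
  note e = E[of a p n] E[of b p' n']
  have "a = b"
    using once[of b a "nview n"] e assms NEWLEADER n' who_in_procs[of b] all_correct by auto
  with e assms NEWLEADER n' show ?thesis by (metis view_of.simps(1))
next
  case (PROPOSE j w x M)
  then obtain j' x' M' where "m' = PROPOSE j' w x' M'" using assms(3,4) by (cases m') auto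
  with PROPOSE assms propose_unique[of a q p j w x M b q p' j' x' M'] sent_from_view(2)[of a q p]
    sent_from_view(2)[of b q p'] show ?thesis by fastforce
next
  case (PREPARED n)
  then obtain n' where n': "m' = PREPARED n'" using assms(3) by (cases m') auto
  obtain j w h where n: "n = Prepared j w h" by (cases n)
  obtain j' w' h' where nn: "n' = Prepared j' w' h'" by (cases n')
  have "w' = w" using assms(4) PREPARED n n' nn by simp
  then show ?thesis
    using prepared_unique[of a q p j w h b p' j' h'] assms(1,2) PREPARED n n' nn
      sent_from_view(2)[OF assms(1)] sent_from_view(2)[OF assms(2)] by simp
next
  case (COMMITTED j w h)
  then show ?thesis using assms(5) by blast
qed

section \<open>Entry times of views\<close>

text \<open>\<open>Min\<close> and \<open>Max\<close> in \<open>E_first\<close> and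
  \<open>E_last\<close> bound the entry times only if these form a finite set; by
  \<open>once\<close> each process contributes at most one.\<close>

lemma entry_times_finite: "finite {t. \<exists>p\<in>correct P faulty. enters R p w t}"
proof -
  have "finite {t. enters R p w t}" if p: "p \<in> correct P faulty" for p
  proof (cases "\<exists>t. enters R p w t")
    case True
    then obtain t where t: "enters R p w t" by blast
    have "{t. enters R p w t} \<subseteq> {t}"
      using t once[of _ _ w] p unfolding enters_def by blast
    then show ?thesis using finite_subset by blast
  qed simp
  moreover have "finite (correct P faulty)" by (simp add: all_correct finite_procs)
  moreover have "{t. \<exists>p\<in>correct P faulty. enters R p w t} =
      (\<Union>p\<in>correct P faulty. {t. enters R p w t})" by blast
  ultimately show ?thesis by simp
qed

abbreviation first_entry :: "view \<Rightarrow> time" where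
  "first_entry \<equiv> E_first R (correct P faulty)"

abbreviation last_entry :: "view \<Rightarrow> time" where
  "last_entry \<equiv> E_last R (correct P faulty)"

lemma entry_bounds:
  assumes "ev R k = New_View w"
  shows "first_entry w \<le> tm R k" "tm R k \<le> last_entry w"
proof -
  have "tm R k \<in> {t. \<exists>p\<in>correct P faulty. enters R p w t}"
    using assms who_in_procs[of k] all_correct unfolding enters_def by blast
  then show "first_entry w \<le> tm R k" "tm R k \<le> last_entry w"
    unfolding E_first_def E_last_def using entry_times_finite by (auto intro: Min_le Max_ge)
qed

text \<open>\<open>P2\<close> settles V itself. From there on \<open>P5\<close> never moves first
  entries backwards, as F is monotone with F 0 = 0 and hence nonnegative.\<close>

lemma first_entry_ge_GST:
  assumes "v \<ge> V"
  shows "first_entry v \<ge> GST"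
  using assms
proof (induction v rule: dec_induct)
  case base
  then show ?case by (rule P2)
next
  case (step n)
  have "mono F" "F 0 = 0" using timeout by (simp_all add: timeout_function_def)
  then have "0 \<le> F n" using monoD[of F 0 n] by simp
  then show ?case using P5[OF step(1)] step(3) by simp
qed

text \<open>From V on no view is skipped: by \<open>P3\<close> the process also enters v + 1, and by
  \<open>P1\<close> it does so before w.\<close>

lemma later_entry:
  assumes "v \<ge> V" "v < w" "ev R k = New_View w"
  shows "first_entry (v + 1) \<le> tm R k"
proof (cases "w = v + 1")
  case True
  then show ?thesis using entry_bounds assms by blast
next
  case False
  let ?p = "who R k"
  have p: "?p \<in> correct P faulty" using who_in_procs all_correct by blast
  obtain t where t: "enters R ?p (v + 1) t" using P3[OF p, of "v + 1"] assms by auto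
  then have "first_entry (v + 1) \<le> t" using entry_bounds by (auto simp: enters_def)
  moreover have "t < tm R k"
    using P1[OF p, of "v + 1" w t "tm R k"] t assms False by (auto simp: enters_def)
  ultimately show ?thesis by simp
qed

lemma sent_view_bound:
  assumes "v \<ge> V" "sent_at P R k q p m" "tm R k < first_entry (v + 1)"
  shows "view_of m \<le> v"
proof (rule ccontr)
  assume *: "\<not> ?thesis"
  then obtain k' where "k' \<le> k" "ev R k' = New_View (view_of m)"
    using sent_from_view(3)[OF assms(2)] by auto
  then show False
    using later_entry[OF assms(1), of "view_of m" k'] * assms(3) tm_mono
    by (meson monoD not_le order.strict_trans1)
qed

section \<open>The state at a given time, delivery and urgency\<close>

text \<open>Times are monotone and unbounded, so only finitely many steps happen by T. K is the last
  one, which makes \<open>st R (Suc K)\<close> the state in force at time T.\<close>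

lemma horizon:
  assumes "tm R k \<le> T"
  obtains K where "tm R K \<le> T" "T < tm R (Suc K)" "\<And>i. tm R i \<le> T \<Longrightarrow> i \<le> K"
proof -
  obtain B where B: "T < tm R B" using tm_unbounded by blast
  have sub: "{i. tm R i \<le> T} \<subseteq> {..B}"
  proof
    fix i assume "i \<in> {i. tm R i \<le> T}"
    then have "tm R i < tm R B" using B by simp
    then show "i \<in> {..B}" using tm_mono by (metis atMost_iff linorder_not_le monoD nle_le)
  qed
  then have fin: "finite {i. tm R i \<le> T}" using finite_subset by blast
  let ?K = "Max {i. tm R i \<le> T}"
  have "?K \<in> {i. tm R i \<le> T}" using Max_in[OF fin] assms by blast
  moreover have "i \<le> ?K" if "tm R i \<le> T" for i using Max_ge[OF fin] that by simp
  moreover have "T < tm R (Suc ?K)"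
  proof (rule ccontr)
    assume "\<not> ?thesis"
    then have "Suc ?K \<le> ?K" using Max_ge[OF fin, of "Suc ?K"] by simp
    then show False by simp
  qed
  ultimately show ?thesis using that by blast
qed

text \<open>
  Before the first process moves past view v, no message for a higher view exists, so a message
  for view v cannot be displaced from a buffer, not even at a process that has yet to enter v.
\<close>

lemma received_kept:
  assumes "v \<ge> V" "received_at R i p m" "view_of m = v" "\<And>j w h. m \<noteq> COMMITTED j w h"
    and "i < k" "\<And>j. j < k \<Longrightarrow> tm R j < first_entry (v + 1)"
  shows "m \<in> inbox (st R k p)"
proof -
  obtain a where a: "sent_at P R a (signer m) p m" using received_sent assms(2) by blast
  have bound: "view_of m' \<le> v" if rec: "received_at R j p m'" "j < k" for j m'
  proof -
    obtain b where "b < j" "sent_at P R b (signer m') p m'" using received_sent[OF rec(1)] by blast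
    then show ?thesis using sent_view_bound[OF assms(1)] assms(6)[of b] rec(2) by simp
  qed
  have "Suc i \<le> k" using assms(5) by simp
  then show ?thesis
  proof (induction k rule: dec_induct)
    case base
    have st: "st R (Suc i) p = (st R i p)\<lparr>inbox := store m (st R i p)\<rparr>"
      using assms(2) by (simp add: st_Suc received_at_def)
    show ?case
    proof (cases "view_of m \<le> curr_view (st R i p)")
      case True
      then show ?thesis by (simp add: st store_def)
    next
      case False
      show ?thesis
      proof (cases "\<exists>m'\<in>buffered_like (st R i p) m. view_of m \<le> view_of m'")
        case True
        then obtain m' where m': "m' \<in> inbox (st R i p)" "same_type m m'" "signer m' = signer m"
          "view_of m \<le> view_of m'" by (auto simp: buffered_like_def)
        obtain j where j: "j < i" "received_at R j p m'" using inbox_received[OF m'(1)] by blast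
        have "view_of m' \<le> v" using bound[OF j(2)] j(1) assms(5) by simp
        then have eq: "view_of m = view_of m'" using m'(4) assms(3) by simp
        obtain b where "sent_at P R b (signer m') p m'" using received_sent[OF j(2)] by blast
        \<comment> \<open>The kept message was sent as well, and its view is exactly v, so
          uniqueness identifies it with m.\<close>
        then have "m = m'"
          using message_unique[OF a _ m'(2) eq assms(4)] unfolding m'(3) by blast
        with m'(1) have "m \<in> inbox (st R i p)" by blast
        then show ?thesis using True by (simp add: st store_def)
      next
        case False
        with \<open>\<not> view_of m \<le> _\<close> show ?thesis by (simp add: st store_def)
      qed
    qed
  next
    case (step n)
    note m = step.IH
    show ?case
    proof (cases "\<exists>m'. received_at R n p m'")
      case True
      then obtain m' where m': "received_at R n p m'" by blast
      \<comment> \<open>A message displaced by m' has a view strictly below that of m', hence below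
        v, so m survives.\<close>
      have "view_of m' \<le> v" using bound[OF m' step.hyps(2)] .
      then show ?thesis
        using m m' assms(3) by (auto simp: received_at_def st_Suc store_def)
    next
      case False
      then show ?thesis using m
        by (cases "ev R n") (auto simp: st_Suc received_at_def)
    qed
  qed
qed

text \<open>Sending for view v requires having entered v, hence happens at GST or later, so the
  message arrives within \<delta>. It is still there at T because all steps up to T precede the
  first entry to v + 1.\<close>

lemma delivered:
  assumes "v \<ge> V" "sent_at P R i q p m" "view_of m = v" "\<And>j w h. m \<noteq> COMMITTED j w h"
    and "p \<in> procs P" "tm R i + \<delta> \<le> T" "T < first_entry (v + 1)"
    and K: "tm R K \<le> T" "\<And>i. tm R i \<le> T \<Longrightarrow> i \<le> K"
  shows "m \<in> inbox (st R (Suc K) p)"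
proof -
  have "view_of m \<noteq> 0" using assms V_pos by auto
  then obtain e where e: "e \<le> i" "ev R e = New_View v"
    using sent_from_view(3)[OF assms(2)] assms(3) by auto
  have "GST \<le> tm R e" using first_entry_ge_GST[OF assms(1)] entry_bounds(1)[OF e(2)] by simp
  also have "\<dots> \<le> tm R i" using tm_mono e(1) by (simp add: monoD)
  finally have GST: "GST \<le> tm R i" .
  have "q \<in> correct P faulty"
    using sent_from_view(1)[OF assms(2)] who_in_procs all_correct by blast
  then obtain j where j: "received_at R j p m" "tm R j \<le> tm R i + \<delta>"
    using timely[OF assms(2) _ _ GST] assms(5) all_correct by auto
  then have "j < Suc K" using K(2)[of j] assms(6) by simp
  moreover have "tm R l < first_entry (v + 1)" if "l < Suc K" for l
    using that K(1) assms(7) tm_mono by (metis less_Suc_eq_le monoD order.strict_trans1)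
  ultimately show ?thesis using received_kept[OF assms(1) j(1) assms(3,4)] by blast
qed

lemma entry_step:
  assumes "v \<ge> V" "p \<in> procs P"
  obtains k where "who R k = p" "ev R k = New_View v" "tm R k \<le> last_entry v"
proof -
  obtain t where "enters R p v t" using P3 assms all_correct by blast
  then show ?thesis using that entry_bounds(2) by (auto simp: enters_def)
qed

text \<open>All processes have entered v by T, and any entry to a higher view happens at
  \<open>first_entry (v + 1)\<close> or later.\<close>

lemma in_view:
  assumes "v \<ge> V" "p \<in> procs P" "last_entry v \<le> T" "T < first_entry (v + 1)"
    and K: "tm R K \<le> T" "\<And>i. tm R i \<le> T \<Longrightarrow> i \<le> K"
  shows "curr_view (st R (Suc K) p) = v"
proof -
  obtain e where e: "who R e = p" "ev R e = New_View v" "tm R e \<le> last_entry v"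
    using entry_step assms(1,2) by blast
  have "e \<le> K" using K(2) e(3) assms(3) by simp
  then have "v \<le> curr_view (st R (Suc K) p)"
    using curr_view_mono[of "Suc e" "Suc K" p] e by (simp add: st_Suc)
  moreover have "\<not> v < curr_view (st R (Suc K) p)"
  proof
    assume *: "v < curr_view (st R (Suc K) p)"
    then obtain k where "k \<le> K" "ev R k = New_View (curr_view (st R (Suc K) p))"
      using curr_view_entered[of "Suc K" p] by (auto simp: less_Suc_eq_le)
    then have "first_entry (v + 1) \<le> tm R K"
      using later_entry[OF assms(1) *, of k] tm_mono by (meson monoD order_trans)
    then show False using K(1) assms(4) by simp
  qed
  ultimately show ?thesis by simp
qed

text \<open>Urgency is applied with the clock at T rather than at step K: the handler is not pending
  although e is enabled, so it is in \<open>handled\<close>. That set covers the current view only,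
  and this view is v.\<close>

lemma handler_done:
  assumes "v \<ge> V" "p \<in> procs P" "last_entry v \<le> T" "T < first_entry (v + 1)"
    and K: "tm R K \<le> T" "T < tm R (Suc K)" "\<And>i. tm R i \<le> T \<Longrightarrow> i \<le> K"
    and e: "handler_of e = Some h" "enabled P p (clk p T) (st R (Suc K) p) e"
  obtains k where "who R k = p" "handler_of (ev R k) = Some h" "curr_view (st R k p) = v"
    "tm R k \<le> T"
proof -
  have "\<not> pending P p (clk p T) (st R (Suc K) p)"
    using urgent[of p K T] K assms(2) all_correct by auto
  with e have "h \<in> handled (st R (Suc K) p)" unfolding pending_def by blast
  then obtain k where "k < Suc K" "who R k = p" "handler_of (ev R k) = Some h"
    "curr_view (st R k p) = curr_view (st R (Suc K) p)" using handled_event by blast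
  moreover have "curr_view (st R (Suc K) p) = v" using in_view assms by blast
  moreover have "tm R k \<le> T"
    using \<open>k < Suc K\<close> K(1) tm_mono by (meson less_Suc_eq_le monoD order_trans)
  ultimately show ?thesis using that by simp
qed

section \<open>Validity of NEWLEADER messages and proposals\<close>

text \<open>The fields come from a state satisfying \<open>well_formed\<close>; the strict bound on
  \<open>npre\<close> holds because the entry raises \<open>curr_view\<close>.\<close>

lemma newleader_sent:
  assumes "sent_at P R k q p (NEWLEADER m)"
  shows "valid_newleader P m"
    and "npre m \<noteq> 0 \<Longrightarrow> \<exists>y. ncur m = Some y \<and> valid P y"
    and "nlocked m \<noteq> 0 \<Longrightarrow> \<exists>y. nval m = Some y \<and> valid P y"
proof -
  have m: "who R k = q" "ev R k = New_View (nview m)" "m = Newleader q (nview m)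
      (locked_view (st R k q)) (prepared_val (st R k q)) (cert (st R k q))
      (pre_view (st R k q)) (curr_val (st R k q))"
    using assms by (cases "ev R k"; auto simp: sent_at_def split: if_splits)+
  have "nlocked m = locked_view (st R k q)" "nval m = prepared_val (st R k q)"
    "ncert m = cert (st R k q)" "npre m = pre_view (st R k q)" "ncur m = curr_val (st R k q)"
    by (subst m(3), simp)+
  moreover note well_formed_st[of k q] new_view_increases[OF m(1,2)]
  ultimately show "valid_newleader P m"
    and "npre m \<noteq> 0 \<Longrightarrow> \<exists>y. ncur m = Some y \<and> valid P y"
    and "nlocked m \<noteq> 0 \<Longrightarrow> \<exists>y. nval m = Some y \<and> valid P y"
    by (auto simp: well_formed_def valid_newleader_def)
qed

text \<open>By unforgeability every signature in the two certificates was really issued. A common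
  signer has voted only once in that view, so the hashes agree, and \<open>hash\<close> is
  injective.\<close>

lemma locked_value_unique:
  assumes "NEWLEADER m \<in> inbox (st R k p)" "NEWLEADER m' \<in> inbox (st R k p)"
    and "nlocked m = nlocked m'" "nlocked m \<noteq> 0"
  shows "nval m = nval m'"
proof -
  have cert: "\<exists>Q\<subseteq>procs P. card Q \<ge> 2 * max_faulty P + 1 \<and>
      (\<forall>j\<in>Q. \<exists>i q. sent_at P R i j q (PREPARED (Prepared j (nlocked n) (hash P (nval n)))))"
    if n: "NEWLEADER n \<in> inbox (st R k p)" "nlocked n \<noteq> 0" for n
  proof -
    have "valid_newleader P n" using inbox_sent[OF n(1)] newleader_sent(1) by blast
    then obtain C where C: "ncert n = Some C" "prepared P C (nlocked n) (hash P (nval n))"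
      using n(2) by (auto simp: valid_newleader_def)
    obtain Q where Q: "Q \<subseteq> procs P" "card Q \<ge> 2 * max_faulty P + 1"
      "C = (\<lambda>j. Prepared j (nlocked n) (hash P (nval n))) ` Q"
      using C(2) by (auto simp: prepared_def)
    obtain i where i: "received_at R i p (NEWLEADER n)" using inbox_received[OF n(1)] by blast
    have "\<exists>i q. sent_at P R i j q (PREPARED (Prepared j (nlocked n) (hash P (nval n))))"
      if j: "j \<in> Q" for j
      using unforgeable[OF i, of "PREPARED (Prepared j (nlocked n) (hash P (nval n)))"]
        j C(1) Q all_correct by (auto simp: newleader_parts_def)
    with Q show ?thesis by blast
  qed
  obtain Q where Q: "Q \<subseteq> procs P" "card Q \<ge> 2 * max_faulty P + 1"
    "\<forall>j\<in>Q. \<exists>i q. sent_at P R i j q (PREPARED (Prepared j (nlocked m) (hash P (nval m))))"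
    using cert[OF assms(1,4)] by blast
  obtain Q' where Q': "Q' \<subseteq> procs P" "card Q' \<ge> 2 * max_faulty P + 1"
    "\<forall>j\<in>Q'. \<exists>i q. sent_at P R i j q (PREPARED (Prepared j (nlocked m) (hash P (nval m'))))"
    using cert[OF assms(2)] assms(3,4) by auto
  obtain j where "j \<in> Q" "j \<in> Q'"
    using large_sets_intersect[OF Q(1) Q'(1) Q(2) Q'(2)] by blast
  with Q(3) Q'(3) have "hash P (nval m) = hash P (nval m')" using prepared_unique by metis
  then show ?thesis using collision_resistant by (simp add: inj_eq)
qed

text \<open>The receiver p' repeats the selection with its own \<open>pick\<close>, which enters the
  slow part alone; there \<open>locked_value_unique\<close> gives the same value. Validity of x is
  inherited from the NEWLEADER messages or from \<open>myval\<close>.\<close>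

lemma proposal_safe:
  assumes "sent_at P R k q p (PROPOSE j w x M)"
  shows "safe_proposal P p' j w x M"
proof (cases "w = 1")
  case True
  note c = propose_cases[OF assms]
  have "valid P (myval P j)"
    using valid_myval c(2) who_in_procs all_correct by metis
  with True c show ?thesis by (auto simp: safe_proposal_def)
next
  case False
  with propose_cases[OF assms] have j: "who R k = j" "j = leader P w"
    and x: "x = proposal P j M" and M: "newleader_quorum P w M"
    and inbox: "\<And>m. m \<in> M \<Longrightarrow> NEWLEADER m \<in> inbox (st R k j)" by auto
  note fin = newleader_quorum_finite[OF M]
  have slow: "select_slow P p' M = select_slow P j M"
  proof (cases "Max (nlocked ` M) = 0")
    case False
    with pick[OF fin, of j] pick[OF fin, of p'] locked_value_unique inbox
    have "nval (pick P p' M) = nval (pick P j M)" by metis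
    with pick[OF fin] show ?thesis by (simp add: select_slow_def)
  qed (simp add: select_slow_def)
  obtain xs vs where s: "select_slow P j M = (xs, vs)" by fastforce
  obtain xf vf where f: "select_fast P M = (xf, vf)" by fastforce
  have xs: "\<exists>y. xs = Some y \<and> valid P y" if "vs > 0"
  proof -
    let ?m = "pick P j M"
    have "xs = nval ?m" "nlocked ?m \<noteq> 0"
      using s that by (auto simp: select_slow_def split: if_splits)
    moreover have "NEWLEADER ?m \<in> inbox (st R k j)" using pick[OF fin] inbox by blast
    ultimately show ?thesis using inbox_sent newleader_sent(3) by blast
  qed
  have xf: "\<exists>y. xf = Some y \<and> valid P y" if "vf > 0"
  proof -
    have "(xf, vf) \<in> fast_candidates P M" using select_fast_candidate f that by simp
    then obtain N where N: "N \<subseteq> M" "card N = max_faulty P + 1" "\<forall>m\<in>N. ncur m = xf"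
      "vf = Min (npre ` N)" by (auto simp: fast_candidates_def)
    have "finite N" "N \<noteq> {}" using N(1,2) fin(1) finite_subset by auto
    \<comment> \<open>N has f + 1 members, so the minimum is attained; the message attaining it has
      nonzero \<open>npre\<close> and thus a valid \<open>ncur\<close>.\<close>
    then have "vf \<in> npre ` N" using N(4) by simp
    then obtain m where "m \<in> N" "vf = npre m" by blast
    moreover from this have "NEWLEADER m \<in> inbox (st R k j)" using N(1) inbox by blast
    ultimately show ?thesis using inbox_sent newleader_sent(2) N(3) that by (metis less_not_refl)
  qed
  have "valid P (myval P j)" using valid_myval j(1) who_in_procs all_correct by metis
  moreover have "x = (if vf \<le> vs \<and> 0 < vs then xs else if vs < vf then xf else Some (myval P j))"
    using x by (simp add: proposal_def s f)
  ultimately show ?thesis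
    using xs xf M j(2) unfolding safe_proposal_def slow s f by auto
qed

section \<open>Proposal, votes and decision in view v\<close>

text \<open>Outside view 1, NEWLEADER messages are sent on entry, hence delivered by
  \<open>last_entry v + \<delta>\<close>. M is left open, since the leader may have proposed earlier
  from a different quorum.\<close>

lemma leader_proposes:
  assumes "v \<ge> V" "last_entry v + \<delta> < first_entry (v + 1)"
  obtains k x M where "tm R k \<le> last_entry v + \<delta>"
    "\<And>p. p \<in> procs P \<Longrightarrow> sent_at P R k (leader P v) p (PROPOSE (leader P v) v x M)"
proof (cases "v = 1")
  case True
  obtain k where k: "who R k = leader P v" "ev R k = New_View v" "tm R k \<le> last_entry v"
    using entry_step[OF assms(1) leader_in_procs] by blast
  show ?thesis
  proof (rule that)
    show "tm R k \<le> last_entry v + \<delta>" using k(3) delta_nonneg by simp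
    show "sent_at P R k (leader P v) p
        (PROPOSE (leader P v) v (Some (myval P (leader P v))) {})" if "p \<in> procs P" for p
      using k True that by (simp add: sent_at_def)
  qed
next
  case False
  let ?l = "leader P v" and ?T = "last_entry v + \<delta>"
  obtain e0 where "tm R e0 \<le> last_entry v"
    using entry_step[OF assms(1) leader_in_procs] by blast
  then have "tm R e0 \<le> ?T" using delta_nonneg by simp
  then obtain K where K: "tm R K \<le> ?T" "?T < tm R (Suc K)" "\<And>i. tm R i \<le> ?T \<Longrightarrow> i \<le> K"
    using horizon by blast
  let ?s = "st R (Suc K) ?l"
  have view: "curr_view ?s = v"
    using in_view[OF assms(1) leader_in_procs _ assms(2) K(1,3)] delta_nonneg by simp
  have "\<exists>m. nsigner m = q \<and> nview m = v \<and> valid_newleader P m \<and> NEWLEADER m \<in> inbox ?s"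
    if "q \<in> procs P" for q
  proof -
    obtain e where e: "who R e = q" "ev R e = New_View v" "tm R e \<le> last_entry v"
      using entry_step[OF assms(1) \<open>q \<in> procs P\<close>] by blast
    then obtain m where m: "sent_at P R e q ?l (NEWLEADER m)" "nsigner m = q" "nview m = v"
      using False by (auto simp: sent_at_def)
    then have "NEWLEADER m \<in> inbox ?s"
      using delivered[OF assms(1) m(1) _ _ leader_in_procs _ assms(2) K(1,3)] e(3) by simp
    with m newleader_sent(1) show ?thesis by blast
  qed
  then obtain n where n: "\<And>q. q \<in> procs P \<Longrightarrow> nsigner (n q) = q \<and> nview (n q) = v \<and>
      valid_newleader P (n q) \<and> NEWLEADER (n q) \<in> inbox ?s" by metis
  obtain Q where Q: "quorum P Q" using quorum_exists by blast
  then have sub: "Q \<subseteq> procs P" by (simp add: quorum_def)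
  have "bij_betw nsigner (n ` Q) Q"
    using n sub by (intro bij_betw_byWitness[where f' = n]) auto
  with Q n sub have "newleader_quorum P v (n ` Q)"
    unfolding newleader_quorum_def by blast
  moreover have "NEWLEADER ` n ` Q \<subseteq> inbox ?s" using n sub by blast
  ultimately have en: "enabled P ?l (clk ?l ?T) ?s (Lead (n ` Q))" if "Leading \<notin> handled ?s"
    using view False that by simp
  obtain k where k: "who R k = ?l" "handler_of (ev R k) = Some Leading"
    "curr_view (st R k ?l) = v" "tm R k \<le> ?T"
  proof (cases "Leading \<in> handled ?s")
    case True
    then obtain k where "k < Suc K" "who R k = ?l" "handler_of (ev R k) = Some Leading"
      "curr_view (st R k ?l) = v" using handled_event view by metis
    moreover have "tm R k \<le> ?T"
      using \<open>k < Suc K\<close> K(1) tm_mono by (meson less_Suc_eq_le monoD order_trans)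
    ultimately show ?thesis using that by blast
  next
    case False
    have "last_entry v \<le> ?T" using delta_nonneg by simp
    from handler_done[OF assms(1) leader_in_procs this assms(2) K _ en[OF False]]
    show ?thesis using that by auto
  qed
  obtain M where "ev R k = Lead M" using k(2) by (cases "ev R k") auto
  then have "sent_at P R k ?l p (PROPOSE ?l v (proposal P ?l M) M)" if "p \<in> procs P" for p
    using k that by (simp add: sent_at_def)
  with k(4) show ?thesis using that by blast
qed

lemma vote_value:
  assumes "who R k = p" "ev R k = Vote j x M" "curr_view (st R k p) = v"
    and "sent_at P R i q p' (PROPOSE l v x' M')"
  shows "x = x'"
proof -
  have "PROPOSE j v x M \<in> inbox (st R k p)" using enabled_step[OF assms(1)] assms(2,3) by simp
  then obtain b where "sent_at P R b j p (PROPOSE j v x M)" using inbox_sent by fastforce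
  then show ?thesis using propose_unique(1) assms(4) by blast
qed

text \<open>The hypothesis keeps processes from leaving v before the deadline, which allows one
  \<delta> each for NEWLEADER, PROPOSE and PREPARED.\<close>

lemma fast_decision:
  assumes "v \<ge> V" "last_entry v + 3 * \<delta> < first_entry (v + 1)" "p \<in> procs P"
  shows "\<exists>x t. decides_at R p v x t \<and> t \<le> last_entry v + 3 * \<delta>"
proof -
  have T1: "last_entry v + \<delta> < first_entry (v + 1)"
    and T2: "last_entry v + 2 * \<delta> < first_entry (v + 1)"
    using assms(2) delta_nonneg by auto
  obtain k0 x M where k0: "tm R k0 \<le> last_entry v + \<delta>"
    and proposed: "\<And>p. p \<in> procs P \<Longrightarrow> sent_at P R k0 (leader P v) p (PROPOSE (leader P v) v x M)"
    using leader_proposes[OF assms(1) T1] by blast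
  have "\<exists>k. tm R k \<le> last_entry v + 2 * \<delta> \<and> sent_at P R k q p (PREPARED (Prepared q v (hash P x)))"
    if q: "q \<in> procs P" for q
  proof -
    let ?T = "last_entry v + 2 * \<delta>"
    have le: "last_entry v \<le> ?T" using delta_nonneg by simp
    have "tm R k0 \<le> ?T" using k0 delta_nonneg by simp
    then obtain K where K: "tm R K \<le> ?T" "?T < tm R (Suc K)" "\<And>i. tm R i \<le> ?T \<Longrightarrow> i \<le> K"
      using horizon by blast
    let ?s = "st R (Suc K) q"
    have view: "curr_view ?s = v" using in_view[OF assms(1) q le T2 K(1,3)] .
    have inbox: "PROPOSE (leader P v) v x M \<in> inbox ?s"
      using delivered[OF assms(1) proposed[OF q] _ _ q _ T2 K(1,3)] k0 by simp
    obtain k where k: "who R k = q" "handler_of (ev R k) = Some Voting"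
      "curr_view (st R k q) = v" "tm R k \<le> ?T"
    \<comment> \<open>If \<open>voted\<close> is not set, the proposal in the inbox enables
      \<open>Vote\<close>, and urgency yields a vote all the same.\<close>
    proof (cases "voted ?s = Some True")
      case True
      then obtain k j M' where "k < Suc K" "who R k = q" "ev R k = Vote j (curr_val ?s) M'"
        "curr_view (st R k q) = v" using voted_event view by metis
      moreover have "tm R k \<le> ?T"
        using \<open>k < Suc K\<close> K(1) tm_mono by (meson less_Suc_eq_le monoD order_trans)
      ultimately show ?thesis using that by simp
    next
      case False
      then have "voted ?s = Some False"
        using voted_not_None[of "Suc K" q] view assms(1) V_pos by auto
      then have "enabled P q (clk q ?T) ?s (Vote (leader P v) x M)"
        using inbox view proposal_safe[OF proposed[OF q]] by simp
      from handler_done[OF assms(1) q le T2 K _ this] show ?thesis using that by auto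
    qed
    then obtain j x' M' where ev: "ev R k = Vote j x' M'" by (cases "ev R k") auto
    have "x' = x" using vote_value[OF k(1) ev k(3) proposed[OF q]] .
    with k ev assms(3) show ?thesis by (auto simp: sent_at_def)
  qed
  then obtain kq where kq: "\<And>q. q \<in> procs P \<Longrightarrow> tm R (kq q) \<le> last_entry v + 2 * \<delta> \<and>
      sent_at P R (kq q) q p (PREPARED (Prepared q v (hash P x)))" by metis
  let ?T = "last_entry v + 3 * \<delta>"
  have le: "last_entry v \<le> ?T" using delta_nonneg by simp
  have "tm R k0 \<le> ?T" using k0 delta_nonneg by simp
  then obtain K where K: "tm R K \<le> ?T" "?T < tm R (Suc K)" "\<And>i. tm R i \<le> ?T \<Longrightarrow> i \<le> K"
    using horizon by blast
  let ?s = "st R (Suc K) p"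
  have view: "curr_view ?s = v" using in_view[OF assms(1,3) le assms(2) K(1,3)] .
  have inbox: "PREPARED (Prepared q v (hash P x)) \<in> inbox ?s" if "q \<in> procs P" for q
    using delivered[OF assms(1) _ _ _ assms(3) _ assms(2) K(1,3),
        of "kq q" q "PREPARED (Prepared q v (hash P x))"] kq[OF that] by simp
  have vote: "who R (kq p) = p" "\<exists>j y M. ev R (kq p) = Vote j y M" "curr_view (st R (kq p) p) = v"
    using kq[OF assms(3)]
    by (cases "ev R (kq p)"; auto simp: sent_at_def split: if_splits)+
  have "kq p \<le> K" using K(3)[of "kq p"] kq[OF assms(3)] delta_nonneg by simp
  moreover have "voted (st R (Suc (kq p)) p) = Some True" "curr_view (st R (Suc (kq p)) p) = v"
    using vote by (auto simp: st_Suc)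
  ultimately have voted: "voted ?s = Some True"
    using view_state_persists(2)[of "Suc (kq p)" "Suc K" p] view by simp
  \<comment> \<open>\<open>curr_val\<close> stems from a vote in v, and \<open>vote_value\<close>
    identifies it with the leader's x.\<close>
  then obtain k' j' M' where "who R k' = p" "ev R k' = Vote j' (curr_val ?s) M'"
    "curr_view (st R k' p) = v" using voted_event view by metis
  then have val: "curr_val ?s = x" using vote_value proposed[OF assms(3)] by blast
  \<comment> \<open>\<open>Fast_Decide\<close> takes a bare value whereas \<open>curr_val\<close> is
    an option; a process that has voted holds a proper value.\<close>
  obtain y where y: "x = Some y"
    using well_formed_st[of "Suc K" p] voted val by (auto simp: well_formed_def)
  have "enabled P p (clk p ?T) ?s (Fast_Decide y)"
    using val y voted inbox view by simp
  from handler_done[OF assms(1,3) le assms(2) K _ this]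
  obtain k where k: "who R k = p" "handler_of (ev R k) = Some Fast_Deciding"
    "curr_view (st R k p) = v" "tm R k \<le> ?T" by auto
  then obtain z where "ev R k = Fast_Decide z" by (cases "ev R k") auto
  with k show ?thesis unfolding decides_at_def by blast
qed

end

theorem theorem61:
  fixes P :: "('v, 'h) sbft_params"
    and faulty :: "proc set"
    and GST \<delta> d :: time
    and clk :: "proc \<Rightarrow> time \<Rightarrow> time"
    and R :: "('v, 'h) run"
    and F :: "view \<Rightarrow> time"
    and V v :: view
  assumes "sbft_execution P faulty GST \<delta> clk R"
    and "synchronizer R (correct P faulty) GST F V d"
    and "d = 2 * \<delta>"
    and "correct P faulty = procs P"
    and "v \<ge> V"
    and "F v > 5 * \<delta>"
  shows "\<forall>p \<in> procs P. \<exists>x t. decides_at R p v x t \<and>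
           t \<le> E_last R (correct P faulty) v + 3 * \<delta>"
proof -
  interpret correct_run P faulty GST \<delta> clk R F V d
    using assms by (simp add: correct_run_def correct_run_axioms_def)
  \<comment> \<open>\<open>P4\<close> with d = 2\<delta> bounds the left side by
    \<open>first_entry v\<close> + 5\<delta>, and by \<open>P5\<close> the first entry to v + 1
    comes at least F v > 5\<delta> after that to v.\<close>
  have "last_entry v + 3 * \<delta> < first_entry (v + 1)"
    using P4[OF assms(5)] P5[OF assms(5)] assms(3,6) by simp
  then show ?thesis using fast_decision[OF assms(5)] by blast
qed

end
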